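(* Let $d$ be a positive integer. For $v\in\{0,1\}^d\setminus\{0\}$, the graph of the revlex-initial 0/1-polytope $P^{\prec v}$ has $$\sum_{p=1}^{w(v)}2^{\sigma_p(v)}\Big(\tfrac{\sigma_p(v)}{2}+\sum_{q=p+1}^{w(v)}2^{p-q}\Big(2-\Big(\sum_{r=q+1}^{w(v)}2^{\sigma_r(v)}\Big)2^{-\sigma_q(v)}\Big)\Big)$$ edges. In particular, its average node degree is bounded from above by $d+4$.
   Context: Vectors $x\in\mathbb{R}^d$ have components $x_0,x_1,\dots,x_{d-1}$. For distinct $x,y\in\{0,1\}^d$, $x\prec y$ (reverse-lexicographically smaller) means $x_m<y_m$ for $m=\max\{i: x_i\neq y_i\}$. For $v\in\{0,1\}^d$, $X^{\prec v}:=\{x\in\{0,1\}^d : x\prec v\}$ and $P^{\prec v}:=\operatorname{conv}X^{\prec v}$ (a revlex-initial 0/1-polytope). For $v\in\{0,1\}^d\setminus\{0\}$: $S(v):=\{i\in\{0,\dots,d-1\}: v_i=1\}$, $w(v):=|S(v)|$, and $\sigma_1(v)>\sigma_2(v)>\dots>\sigma_{w(v)}(v)$ are the elements of $S(v)$ in decreasing order. The graph of a polytope has as nodes the vertices of the polytope and as edges its one-dimensional faces. *)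

theory Defs
  imports "HOL-Analysis.Analysis"
begin

text \<open>
  The dimension is \<open>d = CARD('n)\<close>, where \<open>'n\<close> is an arbitrary finite linearly ordered index type
  (such a type exists for every positive cardinality, e.g. the numeral types).  The order on \<open>'n\<close>
  provides the numbering \<open>0, ..., d - 1\<close> of the components.  The natural number argument of
  \<open>comp_at\<close> is meaningful only below \<open>CARD('n)\<close>; all uses below are guarded accordingly.
\<close>

definition comp_at :: "real ^ 'n::{finite,linorder} \<Rightarrow> nat \<Rightarrow> real" where
  "comp_at x i = x $ (sorted_list_of_set (UNIV :: 'n set) ! i)"

definition cube01 :: "(real ^ 'n::{finite,linorder}) set" where
  "cube01 = {x. \<forall>i<CARD('n). comp_at x i \<in> {0, 1}}"

definition revlex_less :: "real ^ 'n::{finite,linorder} \<Rightarrow> real ^ 'n::{finite,linorder} \<Rightarrow> bool" (infix "\<prec>" 50) where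
  "x \<prec> y \<longleftrightarrow> x \<noteq> y \<and>
     (let m = Max {i. i < CARD('n) \<and> comp_at x i \<noteq> comp_at y i} in comp_at x m < comp_at y m)"

definition revlex_initial_set :: "real ^ 'n::{finite,linorder} \<Rightarrow> (real ^ 'n::{finite,linorder}) set" where
  "revlex_initial_set v = {x \<in> cube01. x \<prec> v}"

definition revlex_initial_polytope :: "real ^ 'n::{finite,linorder} \<Rightarrow> (real ^ 'n::{finite,linorder}) set" where
  "revlex_initial_polytope v = convex hull (revlex_initial_set v)"

definition supp :: "real ^ 'n::{finite,linorder} \<Rightarrow> nat set" where
  "supp v = {i. i < CARD('n) \<and> comp_at v i = 1}"

definition weight :: "real ^ 'n::{finite,linorder} \<Rightarrow> nat" where
  "weight v = card (supp v)"

text \<open>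
  \<open>sigma_nth v p\<close> is the \<open>p\<close>-th largest element of \<open>supp v\<close>, counting from 1; it is meaningful for
  \<open>1 \<le> p \<le> weight v\<close> only.
\<close>

definition sigma_nth :: "real ^ 'n::{finite,linorder} \<Rightarrow> nat \<Rightarrow> nat" where
  "sigma_nth v p = rev (sorted_list_of_set (supp v)) ! (p - 1)"

definition graph_nodes :: "'a::euclidean_space set \<Rightarrow> 'a set" where
  "graph_nodes P = {x. x extreme_point_of P}"

definition graph_edges :: "'a::euclidean_space set \<Rightarrow> 'a set set" where
  "graph_edges P = {e. e edge_of P}"

text \<open>
  Edges are one-dimensional faces, that is, segments; since a node is an extreme point, it lies in
  such a segment only as an endpoint, so membership is incidence.
\<close>

definition node_degree :: "'a::euclidean_space set \<Rightarrow> 'a \<Rightarrow> nat" where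
  "node_degree P x = card {e \<in> graph_edges P. x \<in> e}"

definition average_node_degree :: "'a::euclidean_space set \<Rightarrow> real" where
  "average_node_degree P =
     (\<Sum>x\<in>graph_nodes P. real (node_degree P x)) / real (card (graph_nodes P))"

end

theory Submission
  imports Defs "HOL-Library.Nat_Bijection"
begin

text \<open>
  A vertex of the cube is read as the binary expansion of a natural number.  Reverse-lexicographic
  comparison then becomes the usual order, and the vertices of the polytope below \<open>v\<close> become the
  initial segment \<open>{..<n}\<close>, where \<open>n\<close> is the number of \<open>v\<close>.

  If \<open>x\<close> and \<open>y\<close> differ in coordinate \<open>i\<close>, exchanging this coordinate between them preserves
  \<open>x + y\<close>.  When both flipped points stay below \<open>n\<close> and are not just \<open>x\<close> and \<open>y\<close> again, the
  midpoint of the segment from \<open>x\<close> to \<open>y\<close> is also the midpoint of another pair of vertices, so the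
  segment is no edge.  These obvious obstructions turn out to be the only ones
  (\<open>segment_edge_iff_rigid\<close>): a pair without them, called rigid, is exposed by an explicit linear
  functional (\<open>rigid_functional\<close>).  The functional is built coordinate by coordinate from below.
  For \<open>2^k < n \<le> 2^(k+1)\<close> the polytope is the convex hull of a full \<open>k\<close>-cube (top coordinate 0)
  and a smaller polytope of the same kind (top coordinate 1).  A pair within one of the two layers
  is handled by a top coefficient so large, or so negative, that the other layer does not matter.
  A pair \<open>x\<close>, \<open>y\<close> across the layers is an edge as soon as some functional has
  \<open>x\<close> as its only maximum on the cube and \<open>y\<close> as its only maximum on the smaller polytope, for the top coefficient can then balance the two values;
  rigid pairs admit such a functional (\<open>rigid_cross\<close>, \<open>visible_functional\<close>).

  The same splitting counts the rigid pairs (\<open>card_rigid_pairs_add\<close>), and one more splitting counts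
  the pairs across the layers (\<open>card_visible_pairs_Suc_low\<close>, \<open>card_visible_pairs_Suc_high\<close>).
  Unfolded along the decreasing list of exponents of \<open>n\<close>, these recursions give the stated
  formula.  Since its sum over \<open>q\<close> is at most 2, the number of edges is at most \<open>n (d + 4) / 2\<close>; the
  degree bound follows because each edge has two endpoints (\<open>sum_node_degree\<close>).
\<close>

section \<open>Binary digits of natural numbers\<close>

lemma nat_eq_bits:
  fixes x y :: nat
  assumes "x < 2 ^ k" "y < 2 ^ k" "\<And>i. i < k \<Longrightarrow> bit x i \<longleftrightarrow> bit y i"
  shows "x = y"
proof -
  have "take_bit k x = take_bit k y"
    using assms(3) by (auto intro!: bit_eqI simp: bit_take_bit_iff)
  then show ?thesis using assms by (simp add: take_bit_nat_eq_self)
qed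

lemma not_bit_above:
  fixes x :: nat
  assumes "x < 2 ^ k" "k \<le> i"
  shows "\<not> bit x i"
  using bit_take_bit_iff[of k x i] assms by (simp add: take_bit_nat_eq_self)

lemma bit_add_exp:
  fixes x :: nat
  assumes "x < 2 ^ k"
  shows "bit (2 ^ k + x) i \<longleftrightarrow> i = k \<or> bit x i"
proof -
  have "2 ^ k + x = set_bit k x"
    using not_bit_above[OF assms] by (simp add: set_bit_eq)
  then show ?thesis by (auto simp: bit_set_bit_iff)
qed

lemma flip_bit_less:
  fixes x :: nat
  assumes "x < 2 ^ k" "i < k"
  shows "flip_bit i x < 2 ^ k"
proof -
  have "take_bit k (flip_bit i x) = flip_bit i x"
    using assms by (simp add: take_bit_flip_bit_eq take_bit_nat_eq_self)
  then show ?thesis by (simp add: take_bit_nat_eq_self_iff)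
qed

lemma flip_bit_add_exp:
  fixes x :: nat
  assumes "x < 2 ^ k" "i < k"
  shows "flip_bit i (2 ^ k + x) = 2 ^ k + flip_bit i x"
proof (rule bit_eqI)
  fix j
  show "bit (flip_bit i (2 ^ k + x)) j \<longleftrightarrow> bit (2 ^ k + flip_bit i x) j"
    unfolding bit_flip_bit_iff bit_add_exp[OF assms(1)] bit_add_exp[OF flip_bit_less[OF assms]]
    using assms(2) by auto
qed

lemma flip_bit_top:
  fixes x :: nat
  assumes "x < 2 ^ k"
  shows "flip_bit k x = 2 ^ k + x" "flip_bit k (2 ^ k + x) = x"
proof -
  have *: "\<not> bit x k" using not_bit_above[OF assms] by simp
  show "flip_bit k x = 2 ^ k + x"
    by (rule bit_eqI) (use * in \<open>auto simp: bit_flip_bit_iff bit_add_exp[OF assms]\<close>)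
  show "flip_bit k (2 ^ k + x) = x"
    by (rule bit_eqI) (use * in \<open>auto simp: bit_flip_bit_iff bit_add_exp[OF assms]\<close>)
qed

lemma less_by_top_bit:
  fixes x y :: nat
  assumes "\<not> bit x m" "bit y m" "\<And>i. i > m \<Longrightarrow> bit x i \<longleftrightarrow> bit y i"
  shows "x < y"
proof -
  have "drop_bit (Suc m) x = drop_bit (Suc m) y"
    by (rule bit_eqI) (simp only: bit_drop_bit_eq o_apply, rule assms(3), simp)
  then have "x div 2 ^ m div 2 = y div 2 ^ m div 2"
    by (simp only: drop_bit_eq_div div_mult2_eq power_Suc2)
  moreover have "even (x div 2 ^ m)" "odd (y div 2 ^ m)"
    using assms(1,2) by (simp_all add: bit_iff_odd)
  moreover have "a < b" if "a div 2 = b div 2" "even a" "odd b" for a b :: nat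
    using that by presburger
  ultimately have "x div 2 ^ m < y div 2 ^ m" by blast
  then show ?thesis by (meson div_le_mono linorder_not_le)
qed

lemma less_split_exp:
  fixes x :: nat
  assumes "x < 2 ^ k + m"
  obtains "x < 2 ^ k" | x' where "x = 2 ^ k + x'" "x' < m"
proof (cases "x < 2 ^ k")
  case False
  then have "x = 2 ^ k + (x - 2 ^ k)" "x - 2 ^ k < m" using assms by auto
  then show ?thesis using that by blast
qed

section \<open>Single-coordinate swaps\<close>

text \<open>
  The rigidity condition for a pair across two layers: \<open>x\<close> is a vertex of the bottom \<open>k\<close>-cube and
  \<open>y < m\<close> one of the top layer, with its top bit removed.  A flip of \<open>x\<close> below \<open>k\<close> never leaves the cube, so only the flip
  of \<open>y\<close> can prevent the exchange.  The name refers to \<open>visible_functional\<close>: some direction in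
  the open orthant of \<open>x\<close> has \<open>y\<close> as its only maximum among the vertices below \<open>m\<close>.
\<close>

definition visible :: "nat \<Rightarrow> nat \<Rightarrow> nat \<Rightarrow> nat \<Rightarrow> bool" where
  "visible k m x y \<longleftrightarrow> (\<forall>i<k. bit x i \<noteq> bit y i \<longrightarrow> m \<le> flip_bit i y)"

text \<open>
  No exchange of a single coordinate between \<open>x\<close> and \<open>y\<close> produces a different pair below \<open>n\<close>.
  The equation \<open>flip_bit i x = y\<close> is the case where the exchange only renames the pair.
\<close>

definition rigid :: "nat \<Rightarrow> nat \<Rightarrow> nat \<Rightarrow> bool" where
  "rigid n x y \<longleftrightarrow>
     (\<forall>i. bit x i \<noteq> bit y i \<longrightarrow> flip_bit i x < n \<longrightarrow> flip_bit i y < n \<longrightarrow> flip_bit i x = y)"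

lemma visibleI: "(\<And>i. i < k \<Longrightarrow> bit x i \<noteq> bit y i \<Longrightarrow> m \<le> flip_bit i y) \<Longrightarrow> visible k m x y"
  by (simp add: visible_def)

lemma visibleD: "visible k m x y \<Longrightarrow> i < k \<Longrightarrow> bit x i \<noteq> bit y i \<Longrightarrow> m \<le> flip_bit i y"
  by (simp add: visible_def)

lemma rigidI:
  "(\<And>i. bit x i \<noteq> bit y i \<Longrightarrow> flip_bit i x < n \<Longrightarrow> flip_bit i y < n \<Longrightarrow> flip_bit i x = y) \<Longrightarrow> rigid n x y"
  by (simp add: rigid_def)

lemma rigidD:
  "rigid n x y \<Longrightarrow> bit x i \<noteq> bit y i \<Longrightarrow> flip_bit i x < n \<Longrightarrow> flip_bit i y < n \<Longrightarrow> flip_bit i x = y"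
  by (simp add: rigid_def)

lemma visible_Suc:
  "visible (Suc k) m x y \<longleftrightarrow> visible k m x y \<and> (bit x k \<noteq> bit y k \<longrightarrow> m \<le> flip_bit k y)"
  by (auto simp: visible_def less_Suc_eq)

lemma visible_add_exp_left:
  assumes "x < 2 ^ k"
  shows "visible k m (2 ^ k + x) y \<longleftrightarrow> visible k m x y"
  by (auto simp: visible_def bit_add_exp[OF assms])

lemma visible_low:
  assumes "x < 2 ^ k" "y < 2 ^ k" "2 ^ k \<le> m"
  shows "visible k m x y \<longleftrightarrow> x = y"
proof
  assume v: "visible k m x y"
  show "x = y"
  proof (rule nat_eq_bits[OF assms(1,2)], rule ccontr)
    fix i assume "i < k" "bit x i \<noteq> bit y i"
    then show False using visibleD[OF v] flip_bit_less[OF assms(2), of i] assms(3) by fastforce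
  qed
qed (simp add: visible_def)

lemma visible_high:
  assumes "y < 2 ^ k"
  shows "visible k (2 ^ k + m) x (2 ^ k + y) \<longleftrightarrow> visible k m x y"
  by (auto simp: visible_def bit_add_exp assms flip_bit_add_exp)

text \<open>
  Flipping bit \<open>k\<close> of \<open>y\<close> gives a number that is at least \<open>2 ^ k\<close>, hence at least \<open>m\<close>: the bit of
  \<open>x\<close> at position \<open>k\<close> is free.
\<close>

lemma visible_Suc_low:
  assumes "x < 2 ^ k" "y < 2 ^ k" "m \<le> 2 ^ k"
  shows "visible (Suc k) m (2 ^ k + x) y \<longleftrightarrow> visible k m x y"
    and "visible (Suc k) m x y \<longleftrightarrow> visible k m x y"
  using assms not_bit_above[of x k k] not_bit_above[of y k k] 
  by (simp_all add: visible_Suc visible_add_exp_left flip_bit_top)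

text \<open>
  If \<open>y\<close> is in the lower half, all flips below \<open>k\<close> are harmless and force agreement, while the flip
  at \<open>k\<close> leads to \<open>2 ^ k + y\<close>.  If it is in the upper half, the flip at \<open>k\<close> leads down and
  forces the top bit of \<open>x\<close>, and the common top bits can be dropped.
\<close>

lemma visible_Suc_split:
  assumes "x < 2 ^ k" "y < 2 ^ k"
  shows "visible (Suc k) (2 ^ k + m) x y \<longleftrightarrow> x = y"
    and "visible (Suc k) (2 ^ k + m) (2 ^ k + x) y \<longleftrightarrow> x = y \<and> m \<le> y"
    and "y < m \<Longrightarrow> visible (Suc k) (2 ^ k + m) x (2 ^ k + y) \<longleftrightarrow> False"
    and "visible (Suc k) (2 ^ k + m) (2 ^ k + x) (2 ^ k + y) \<longleftrightarrow> visible k m x y"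
  using assms not_bit_above[of x k k] not_bit_above[of y k k]
  by (auto simp: visible_Suc visible_add_exp_left flip_bit_top visible_low visible_high bit_add_exp)

lemma differing_bit_less:
  fixes x y :: nat
  assumes "x < 2 ^ k" "y < 2 ^ k" "bit x i \<noteq> bit y i"
  shows "i < k"
  using assms not_bit_above[of x k i] not_bit_above[of y k i] by (meson linorder_not_le)

lemma rigid_low:
  assumes "x < 2 ^ k" "y < 2 ^ k" "2 ^ k \<le> n"
  shows "rigid n x y \<longleftrightarrow> (\<forall>i. bit x i \<noteq> bit y i \<longrightarrow> flip_bit i x = y)"
proof -
  have "flip_bit i x < n \<and> flip_bit i y < n" if "bit x i \<noteq> bit y i" for i
    using differing_bit_less[OF assms(1,2) that] flip_bit_less assms by (meson order_less_le_trans)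
  then show ?thesis by (auto simp: rigid_def)
qed

lemma rigid_high:
  assumes "x < 2 ^ k" "y < 2 ^ k"
  shows "rigid (2 ^ k + m) (2 ^ k + x) (2 ^ k + y) \<longleftrightarrow> rigid m x y"
proof -
  have "(bit (2 ^ k + x) i \<noteq> bit (2 ^ k + y) i \<longrightarrow> flip_bit i (2 ^ k + x) < 2 ^ k + m \<longrightarrow>
      flip_bit i (2 ^ k + y) < 2 ^ k + m \<longrightarrow> flip_bit i (2 ^ k + x) = 2 ^ k + y) \<longleftrightarrow>
     (bit x i \<noteq> bit y i \<longrightarrow> flip_bit i x < m \<longrightarrow> flip_bit i y < m \<longrightarrow> flip_bit i x = y)" for i
  proof (cases "i < k")
    case True
    then show ?thesis by (simp add: bit_add_exp assms flip_bit_add_exp)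
  next
    case False
    then have "\<not> bit x i" "\<not> bit y i" using not_bit_above assms by auto
    then show ?thesis by (simp add: bit_add_exp assms)
  qed
  then show ?thesis unfolding rigid_def by blast
qed

text \<open>
  The only exchange that visibility ignores is the one of the top bit.  It is possible only if
  \<open>x < m\<close>.  For a visible pair with \<open>x \<noteq> y\<close> this cannot happen: all differing bits belong to
  \<open>x\<close>, so \<open>x\<close> is at least as large as some flip of \<open>y\<close>, hence at least \<open>m\<close>.  For \<open>x = y\<close> the
  exchange only renames the pair.
\<close>

lemma rigid_cross:
  assumes "x < 2 ^ k" "y < m" "m \<le> 2 ^ k"
  shows "rigid (2 ^ k + m) x (2 ^ k + y) \<longleftrightarrow> visible k m x y"
proof -
  have y: "y < 2 ^ k" using assms by simp
  have neq: "flip_bit i x \<noteq> 2 ^ k + y" if "i < k" for i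
    using flip_bit_less[OF assms(1) that] by simp
  show ?thesis
  proof
    assume r: "rigid (2 ^ k + m) x (2 ^ k + y)"
    show "visible k m x y"
    proof (rule visibleI, rule ccontr)
      fix i assume i: "i < k" "bit x i \<noteq> bit y i" "\<not> m \<le> flip_bit i y"
      have "bit x i \<noteq> bit (2 ^ k + y) i" using i by (simp add: bit_add_exp y)
      moreover have "flip_bit i x < 2 ^ k + m" using flip_bit_less[OF assms(1) i(1)] by simp
      moreover have "flip_bit i (2 ^ k + y) < 2 ^ k + m"
        using i by (simp add: flip_bit_add_exp y)
      ultimately show False using rigidD[OF r] neq[OF i(1)] by blast
    qed
  next
    assume v: "visible k m x y"
    show "rigid (2 ^ k + m) x (2 ^ k + y)"
    proof (rule rigidI)
      fix i assume i: "bit x i \<noteq> bit (2 ^ k + y) i" "flip_bit i x < 2 ^ k + m"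
        "flip_bit i (2 ^ k + y) < 2 ^ k + m"
      show "flip_bit i x = 2 ^ k + y"
      proof (cases "i < k")
        case True
        then have "bit x i \<noteq> bit y i" "\<not> m \<le> flip_bit i y"
          using i by (simp_all add: bit_add_exp y flip_bit_add_exp)
        then show ?thesis using visibleD[OF v True] by blast
      next
        case False
        then have [simp]: "i = k"
          using i not_bit_above[OF assms(1), of i] not_bit_above[OF y, of i] 
          by (simp add: bit_add_exp y)
        have "x < m" using i(2) by (simp add: flip_bit_top assms)
        (* all differing bits are bits of x, hence x is at least each flip of y at such a bit *)
        have "x = y"
        proof (rule ccontr)
          assume "x \<noteq> y"
          then obtain j where j: "j < k" "bit x j \<noteq> bit y j"
            using nat_eq_bits[OF assms(1) y] by blast
          have up: "bit x j'" if "j' < k" "bit x j' \<noteq> bit y j'" for j'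
          proof (rule ccontr)
            assume "\<not> bit x j'"
            with that have b: "bit y j'" by simp
            have "flip_bit j' y < y"
              by (rule less_by_top_bit[of _ j']) (use b in \<open>auto simp: bit_flip_bit_iff\<close>)
            then show False using visibleD[OF v that] assms(2) by simp
          qed
          have "set_decode (flip_bit j y) \<subseteq> set_decode x"
          proof
            fix l assume "l \<in> set_decode (flip_bit j y)"
            then have l: "bit (flip_bit j y) l" by (simp add: set_decode_def bit_iff_odd)
            then have "l < k" using not_bit_above[OF flip_bit_less[OF y j(1)]] by (meson linorder_not_le)
            with l have "bit x l" using up[of l] up[OF j] 
              by (auto simp: bit_flip_bit_iff)
            then show "l \<in> set_decode x" by (simp add: set_decode_def bit_iff_odd)
          qed
          then have "flip_bit j y \<le> x" by (rule subset_decode_imp_le)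
          then show False using visibleD[OF v j] \<open>x < m\<close> by simp
        qed
        then show ?thesis using flip_bit_top(1)[OF assms(1)] by simp
      qed
    qed
  qed
qed

section \<open>Separating functionals on cube vertices\<close>

definition lin :: "nat \<Rightarrow> (nat \<Rightarrow> real) \<Rightarrow> nat \<Rightarrow> real" where
  "lin k c z = (\<Sum>i<k. c i * of_bool (bit z i))"

lemma lin_Suc: "lin (Suc k) c z = lin k c z + c k * of_bool (bit z k)"
  by (simp add: lin_def)

lemma lin_upd [simp]: "lin k (c(k := a)) z = lin k c z"
  unfolding lin_def by (rule sum.cong) auto

lemma lin_add_exp [simp]:
  assumes "z < 2 ^ k"
  shows "lin k c (2 ^ k + z) = lin k c z"
  unfolding lin_def by (rule sum.cong) (auto simp: bit_add_exp[OF assms])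

lemma lin_Suc_low: "z < 2 ^ k \<Longrightarrow> lin (Suc k) (c(k := a)) z = lin k c z"
  using not_bit_above[of z k k] by (simp add: lin_Suc)

lemma lin_Suc_high: "z < 2 ^ k \<Longrightarrow> lin (Suc k) (c(k := a)) (2 ^ k + z) = lin k c z + a"
  by (simp add: lin_Suc bit_add_exp)

text \<open>
  Bounds how much the lower coordinates can contribute, so that a larger top coefficient decides
  every comparison across the layers.
\<close>

lemma lin_spread: "lin k c x - lin k c y \<le> (\<Sum>i<k. \<bar>c i\<bar>)"
  unfolding lin_def sum_subtractf[symmetric]
  by (rule sum_mono) (auto simp: of_bool_def)

lemma lin_gap:
  assumes "\<And>i. i < k \<Longrightarrow> bit x i \<noteq> bit z i \<Longrightarrow> 0 \<le> c i * (of_bool (bit x i) - of_bool (bit z i))"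
    and "j < k" "bit x j \<noteq> bit z j"
  shows "lin k c z + c j * (of_bool (bit x j) - of_bool (bit z j)) \<le> lin k c x"
proof -
  let ?d = "\<lambda>i. c i * (of_bool (bit x i) - of_bool (bit z i))"
  have "?d j \<le> (\<Sum>i<k. ?d i)"
  proof (rule member_le_sum)
    fix i assume "i \<in> {..<k} - {j}"
    then show "0 \<le> ?d i" using assms(1)[of i] by (cases "bit x i = bit z i") auto
  qed (use assms in auto)
  also have "\<dots> = lin k c x - lin k c z"
    by (simp add: lin_def sum_subtractf algebra_simps)
  finally show ?thesis by simp
qed

text \<open>
  The open orthant of functionals whose only maximum over the \<open>k\<close>-cube is \<open>x\<close>.
\<close>

definition points_to :: "nat \<Rightarrow> (nat \<Rightarrow> real) \<Rightarrow> nat \<Rightarrow> bool" where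
  "points_to k c x \<longleftrightarrow> (\<forall>i<k. if bit x i then 0 < c i else c i < 0)"

lemma points_to_max:
  assumes "points_to k c x" "x < 2 ^ k" "z < 2 ^ k" "z \<noteq> x"
  shows "lin k c z < lin k c x"
proof -
  obtain j where j: "j < k" "bit x j \<noteq> bit z j"
    using nat_eq_bits[OF assms(2,3)] assms(4) by metis
  have pos: "0 < c i * (of_bool (bit x i) - of_bool (bit z i))" if "i < k" "bit x i \<noteq> bit z i" for i
    using assms(1) that by (auto simp: points_to_def split: if_splits)
  have "lin k c z + c j * (of_bool (bit x j) - of_bool (bit z j)) \<le> lin k c x"
    by (rule lin_gap) (use pos[THEN less_imp_le] j in auto)
  then show ?thesis using pos[OF j] by linarith
qed

definition toward :: "nat \<Rightarrow> nat \<Rightarrow> real" where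
  "toward x i = (if bit x i then 1 else - 1)"

lemma toward_gap:
  assumes "x < 2 ^ k" "z < 2 ^ k" "z \<noteq> x"
  shows "lin k (toward x) z + 1 \<le> lin k (toward x) x"
proof -
  obtain j where j: "j < k" "bit x j \<noteq> bit z j"
    using nat_eq_bits[OF assms(1,2)] assms(3) by metis
  have "lin k (toward x) z + toward x j * (of_bool (bit x j) - of_bool (bit z j)) \<le> lin k (toward x) x"
    by (rule lin_gap) (use j in \<open>auto simp: toward_def\<close>)
  then show ?thesis using j by (auto simp: toward_def split: if_splits)
qed

text \<open>
  The geometric content of visibility: the open orthant belonging to \<open>x\<close> meets the open normal cone
  of \<open>y\<close> in the convex hull of the vertices below \<open>m\<close>.  In the induction, the top
  coefficient is of any size if the top coordinate vanishes below \<open>m\<close>, small or negative if \<open>y\<close>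
  is in the lower half, and large if \<open>y\<close> is in the upper half.
\<close>

lemma visible_functional:
  assumes "x < 2 ^ k" "y < m" "m \<le> 2 ^ k" "visible k m x y"
  shows "\<exists>c. points_to k c x \<and> (\<forall>z<m. z \<noteq> y \<longrightarrow> lin k c z < lin k c y)"
  using assms
proof (induction k arbitrary: x y m)
  case 0
  then show ?case by (auto simp: points_to_def)
next
  case (Suc k)
  obtain x' b where x': "x' < 2 ^ k" "x = (if b then 2 ^ k + x' else x')"
    using less_split_exp[of x k "2 ^ k"] Suc.prems(1) by (metis mult_2 power_Suc)
  have pt: "points_to (Suc k) (c(k := a)) x" if "points_to k c x'" "if b then 0 < a else a < 0" for c a
    using that x' not_bit_above[of x' k k]
    by (auto simp: points_to_def less_Suc_eq bit_add_exp)
  show ?case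
  proof (cases "m \<le> 2 ^ k")
    case True
    then have y: "y < 2 ^ k" using Suc.prems by simp
    have "visible k m x' y"
      using Suc.prems(4) x' by (cases b) (simp_all add: visible_Suc_low y True)
    then obtain c where c: "points_to k c x'" "\<And>z. z < m \<Longrightarrow> z \<noteq> y \<Longrightarrow> lin k c z < lin k c y"
      using Suc.IH[OF x'(1) Suc.prems(2) True] by blast
    show ?thesis
    proof (intro exI conjI allI impI)
      show "points_to (Suc k) (c(k := if b then 1 else - 1)) x" by (rule pt) (use c in auto)
      fix z assume z: "z < m" "z \<noteq> y"
      then have "z < 2 ^ k" using True by simp
      then show "lin (Suc k) (c(k := if b then 1 else - 1)) z < lin (Suc k) (c(k := if b then 1 else - 1)) y"
        using c(2)[OF z] y by (simp add: lin_Suc_low del: fun_upd_apply)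
    qed
  next
    case False
    then obtain m' where m': "m = 2 ^ k + m'" "m' \<le> 2 ^ k" 
      using Suc.prems(3) by (metis add_le_cancel_left le_Suc_ex mult_2 nat_le_linear power_Suc)
    have "y < 2 ^ k + m'" using Suc.prems m' by simp
    then show ?thesis
    proof (cases rule: less_split_exp)
      case 1
      (* y beats every other cube vertex by at least 1, which 1/2 on top cannot make up for *)
      let ?c = "(toward y)(k := if b then 1 / 2 else - 1)"
      have xy: "x' = y" "b \<Longrightarrow> m' \<le> y"
        using Suc.prems(4) x' m' by (cases b; simp add: visible_Suc_split 1)+
      show ?thesis
      proof (intro exI conjI allI impI)
        show "points_to (Suc k) ?c x" by (rule pt) (use xy in \<open>auto simp: points_to_def toward_def\<close>)
        fix z assume z: "z < m" "z \<noteq> y"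
        have "z < 2 ^ k + m'" using z m' by simp
        then show "lin (Suc k) ?c z < lin (Suc k) ?c y"
        proof (cases rule: less_split_exp)
          case 1
          then show ?thesis using toward_gap[OF \<open>y < 2 ^ k\<close> 1 z(2)] \<open>y < 2 ^ k\<close>
            by (simp add: lin_Suc_low del: fun_upd_apply)
        next
          case (2 z')
          then have z'k: "z' < 2 ^ k" using m' by simp
          show ?thesis
          proof (cases b)
            case True
            then have "z' \<noteq> y" using xy 2 by auto
            then show ?thesis using toward_gap[OF \<open>y < 2 ^ k\<close> z'k] \<open>y < 2 ^ k\<close> z'k True
              by (simp add: lin_Suc_low lin_Suc_high 2 del: fun_upd_apply)
          next
            case False
            have "lin k (toward y) z' \<le> lin k (toward y) y"
              using toward_gap[OF \<open>y < 2 ^ k\<close> z'k] by (cases "z' = y") auto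
            then show ?thesis using \<open>y < 2 ^ k\<close> z'k False
              by (simp add: lin_Suc_low lin_Suc_high 2 del: fun_upd_apply)
          qed
        qed
      qed
    next
      case (2 y')
      then have y'k: "y' < 2 ^ k" using m' by simp
      have b: "b" using Suc.prems(4) x' 2 m' y'k by (cases b) (simp_all add: visible_Suc_split)
      have "visible k m' x' y'" using Suc.prems(4) x' 2 m' y'k b by (simp add: visible_Suc_split)
      then obtain c where c: "points_to k c x'" "\<And>z. z < m' \<Longrightarrow> z \<noteq> y' \<Longrightarrow> lin k c z < lin k c y'"
        using Suc.IH[OF x'(1) 2(2) m'(2)] by blast
      let ?c = "c(k := 1 + (\<Sum>i<k. \<bar>c i\<bar>))"
      show ?thesis
      proof (intro exI conjI allI impI)
        have "0 < 1 + (\<Sum>i<k. \<bar>c i\<bar>)" by (intro add_pos_nonneg sum_nonneg) auto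
        then show "points_to (Suc k) ?c x" by (intro pt) (use c b in auto)
        fix z assume z: "z < m" "z \<noteq> y"
        have "z < 2 ^ k + m'" using z m' by simp
        then show "lin (Suc k) ?c z < lin (Suc k) ?c y"
        proof (cases rule: less_split_exp)
          case 1
          then show ?thesis using lin_spread[of k c z y'] y'k
            by (simp add: lin_Suc_low lin_Suc_high 2 del: fun_upd_apply)
        next
          case (2 z')
          then have "z' < 2 ^ k" "z' \<noteq> y'" using m' z \<open>y = _\<close> by auto
          then show ?thesis using c(2)[OF 2(2)] y'k
            by (simp add: lin_Suc_high 2 \<open>y = _\<close> del: fun_upd_apply)
        qed
      qed
    qed
  qed
qed

text \<open>
  Rigid pairs are exposed.  Within a layer the top coefficient is chosen so large, with the right
  sign, that only this layer matters; across the layers it balances the maxima of the two layers.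
\<close>

lemma rigid_functional:
  assumes "x < y" "y < n" "n \<le> 2 ^ k" "rigid n x y"
  shows "\<exists>c. lin k c x = lin k c y \<and> (\<forall>z<n. z \<noteq> x \<longrightarrow> z \<noteq> y \<longrightarrow> lin k c z < lin k c x)"
  using assms
proof (induction k arbitrary: x y n)
  case 0
  then show ?case by simp
next
  case (Suc k)
  show ?case
  proof (cases "n \<le> 2 ^ k")
    case True
    then obtain c where c: "lin k c x = lin k c y"
      "\<And>z. z < n \<Longrightarrow> z \<noteq> x \<Longrightarrow> z \<noteq> y \<Longrightarrow> lin k c z < lin k c x"
      using Suc by metis
    show ?thesis
      by (rule exI[of _ "c(k := 0)"]) (use c in \<open>simp add: lin_Suc fun_upd_same del: fun_upd_apply\<close>)
  next
    case False
    then obtain m where m: "n = 2 ^ k + m" "m \<le> 2 ^ k" 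
      using Suc.prems(3) by (metis add_le_cancel_left le_Suc_ex mult_2 nat_le_linear power_Suc)
    have "y < 2 ^ k + m" using Suc.prems m by simp
    then show ?thesis
    proof (cases rule: less_split_exp)
      case 1
      then have xk: "x < 2 ^ k" using Suc.prems by simp
      have flip: "bit x i \<noteq> bit y i \<Longrightarrow> flip_bit i x = y" for i
        using Suc.prems(4) rigid_low[OF xk 1] m by simp
      obtain j where j: "j < k" "bit x j \<noteq> bit y j"
        using nat_eq_bits[OF xk 1] Suc.prems(1) by blast
      have other: "bit x i = bit y i" if "i \<noteq> j" for i
        using flip[OF j(2), symmetric] that by (simp add: bit_flip_bit_iff)
      (* rigidity leaves one differing coordinate; ignoring it makes both endpoints optimal *)
      define c where "c = (toward x)(j := 0)"
      have gap: "lin k c z < lin k c x" if z: "z < 2 ^ k" "z \<noteq> x" "z \<noteq> y" for z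
      proof -
        have "\<exists>i<k. i \<noteq> j \<and> bit x i \<noteq> bit z i"
        proof (rule ccontr)
          assume "\<not> ?thesis"
          then have *: "i < k \<Longrightarrow> i \<noteq> j \<Longrightarrow> bit z i \<longleftrightarrow> bit x i" for i by blast
          show False
          proof (cases "bit z j \<longleftrightarrow> bit x j")
            case True
            then have "z = x" by (intro nat_eq_bits[OF z(1) xk]) (use * in blast)
            then show False using z by simp
          next
            case False
            then have "z = y" by (intro nat_eq_bits[OF z(1) 1]) (use * j other in metis)
            then show False using z by simp
          qed
        qed
        then obtain i where i: "i < k" "i \<noteq> j" "bit x i \<noteq> bit z i" by blast
        have "lin k c z + c i * (of_bool (bit x i) - of_bool (bit z i)) \<le> lin k c x"
          by (rule lin_gap) (use i in \<open>auto simp: c_def toward_def\<close>)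
        then show ?thesis using i by (auto simp: c_def toward_def split: if_splits)
      qed
      have eq: "lin k c x = lin k c y"
        unfolding lin_def by (rule sum.cong) (use other in \<open>auto simp: c_def\<close>)
      (* a very negative top coefficient rules out the upper half *)
      let ?c = "c(k := - 1 - (\<Sum>i<k. \<bar>c i\<bar>))"
      show ?thesis
      proof (intro exI conjI allI impI)
        show "lin (Suc k) ?c x = lin (Suc k) ?c y"
          using eq xk 1 by (simp add: lin_Suc_low del: fun_upd_apply)
        fix z assume z: "z < n" "z \<noteq> x" "z \<noteq> y"
        have "z < 2 ^ k + m" using z m by simp
        then show "lin (Suc k) ?c z < lin (Suc k) ?c x"
        proof (cases rule: less_split_exp)
          case 1
          then show ?thesis using gap[OF 1 z(2,3)] xk by (simp add: lin_Suc_low del: fun_upd_apply)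
        next
          case (2 z')
          then have "z' < 2 ^ k" using m by simp
          then show ?thesis using lin_spread[of k c z' x] xk
            by (simp add: lin_Suc_low lin_Suc_high 2 del: fun_upd_apply)
        qed
      qed
    next
      case (2 y')
      then have y'k: "y' < 2 ^ k" using m by simp
      have "x < 2 ^ k + m" using Suc.prems m by simp
      then show ?thesis
      proof (cases rule: less_split_exp)
        case 1
        then have "visible k m x y'" using Suc.prems(4) rigid_cross[OF 1 2(2) m(2)] 2 m by simp
        then obtain c where c: "points_to k c x" "\<And>z. z < m \<Longrightarrow> z \<noteq> y' \<Longrightarrow> lin k c z < lin k c y'"
          using visible_functional[OF 1 2(2) m(2)] by blast
        (* the top coefficient makes the maxima of the two layers equal *)
        let ?c = "c(k := lin k c x - lin k c y')"
        show ?thesis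
        proof (intro exI conjI allI impI)
          show "lin (Suc k) ?c x = lin (Suc k) ?c y"
            using 1 y'k by (simp add: lin_Suc_low lin_Suc_high 2 del: fun_upd_apply)
          fix z assume z: "z < n" "z \<noteq> x" "z \<noteq> y"
          have "z < 2 ^ k + m" using z m by simp
          then show "lin (Suc k) ?c z < lin (Suc k) ?c x"
          proof (cases rule: less_split_exp)
            case 1
            then show ?thesis using points_to_max[OF c(1) \<open>x < 2 ^ k\<close> 1 z(2)] \<open>x < 2 ^ k\<close>
              by (simp add: lin_Suc_low del: fun_upd_apply)
          next
            case (2 z')
            then have "z' < 2 ^ k" "z' \<noteq> y'" using m z \<open>y = _\<close> by auto
            then show ?thesis using c(2)[OF 2(2)] \<open>x < 2 ^ k\<close>
              by (simp add: lin_Suc_low lin_Suc_high 2 del: fun_upd_apply)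
          qed
        qed
      next
        case x': (2 x')
        then have x'k: "x' < 2 ^ k" using m by simp
        have "rigid m x' y'" using Suc.prems(4) rigid_high[OF x'k y'k] x' 2 m by simp
        moreover have "x' < y'" using Suc.prems(1) x' 2 by simp
        ultimately obtain c where c: "lin k c x' = lin k c y'"
          "\<And>z. z < m \<Longrightarrow> z \<noteq> x' \<Longrightarrow> z \<noteq> y' \<Longrightarrow> lin k c z < lin k c x'"
          using Suc.IH[of x' y' m] 2(2) m(2) by blast
        let ?c = "c(k := 1 + (\<Sum>i<k. \<bar>c i\<bar>))"
        show ?thesis
        proof (intro exI conjI allI impI)
          show "lin (Suc k) ?c x = lin (Suc k) ?c y"
            using c x'k y'k by (simp add: lin_Suc_high 2 x' del: fun_upd_apply)
          fix z assume z: "z < n" "z \<noteq> x" "z \<noteq> y"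
          have "z < 2 ^ k + m" using z m by simp
          then show "lin (Suc k) ?c z < lin (Suc k) ?c x"
          proof (cases rule: less_split_exp)
            case 1
            then show ?thesis using lin_spread[of k c z x'] x'k
              by (simp add: lin_Suc_low lin_Suc_high x' del: fun_upd_apply)
          next
            case (2 z')
            then have "z' < 2 ^ k" "z' \<noteq> y'" "z' \<noteq> x'" using m z \<open>y = _\<close> x' by auto
            then show ?thesis using c(2)[OF 2(2)] x'k
              by (simp add: lin_Suc_high 2 x' del: fun_upd_apply)
          qed
        qed
      qed
    qed
  qed
qed

section \<open>Recursive counting of rigid pairs\<close>

definition visible_pairs :: "nat \<Rightarrow> nat \<Rightarrow> (nat \<times> nat) set" where
  "visible_pairs k m = {(x, y). x < 2 ^ k \<and> y < m \<and> visible k m x y}"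

definition rigid_pairs :: "nat \<Rightarrow> (nat \<times> nat) set" where
  "rigid_pairs n = {(x, y). x < y \<and> y < n \<and> rigid n x y}"

lemma finite_visible_pairs [simp]: "finite (visible_pairs k m)"
  by (rule finite_subset[of _ "{..<2 ^ k} \<times> {..<m}"]) (auto simp: visible_pairs_def)

lemma finite_rigid_pairs [simp]: "finite (rigid_pairs n)"
  by (rule finite_subset[of _ "{..<n} \<times> {..<n}"]) (auto simp: rigid_pairs_def)

lemma card_visible_pairs_Suc_low:
  assumes "m \<le> 2 ^ k"
  shows "card (visible_pairs (Suc k) m) = 2 * card (visible_pairs k m)"
proof -
  let ?V = "visible_pairs k m" and ?up = "\<lambda>(x, y). (2 ^ k + x, y :: nat)"
  have "visible_pairs (Suc k) m = ?V \<union> ?up ` ?V"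
  proof (rule set_eqI, clarify)
    fix x y :: nat
    have up: "(x, y) \<in> ?up ` ?V \<longleftrightarrow> (\<exists>x'. x = 2 ^ k + x' \<and> (x', y) \<in> ?V)" by auto
    show "(x, y) \<in> visible_pairs (Suc k) m \<longleftrightarrow> (x, y) \<in> ?V \<union> ?up ` ?V"
    proof (cases "x < 2 ^ k + 2 ^ k")
      case True
      then show ?thesis
      proof (cases rule: less_split_exp)
        case 1
        then show ?thesis using assms unfolding Un_iff up
          by (auto simp: visible_pairs_def visible_Suc_low)
      next
        case (2 x')
        then show ?thesis using assms unfolding Un_iff up
          by (auto simp: visible_pairs_def visible_Suc_low)
      qed
    next
      case False
      then show ?thesis unfolding Un_iff up by (auto simp: visible_pairs_def)
    qed
  qed
  moreover have "inj_on ?up ?V" by (auto simp: inj_on_def)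
  moreover have "?V \<inter> ?up ` ?V = {}" by (auto simp: visible_pairs_def)
  ultimately show ?thesis by (simp add: card_Un_disjoint card_image)
qed

text \<open>
  The vertices in the lower half give a diagonal, together with a shifted copy of its part from \<open>m\<close>
  on; those in the upper half repeat the problem in dimension \<open>k\<close>.
\<close>

lemma card_visible_pairs_Suc_high:
  assumes "m \<le> 2 ^ k"
  shows "card (visible_pairs (Suc k) (2 ^ k + m)) + m = 2 ^ Suc k + card (visible_pairs k m)"
proof -
  let ?V = "visible_pairs k m" and ?up = "\<lambda>(x, y). (2 ^ k + x, 2 ^ k + y) :: nat \<times> nat"
  let ?D = "(\<lambda>y. (y, y)) ` {..<2 ^ k :: nat}" and ?U = "(\<lambda>y. (2 ^ k + y, y)) ` {m..<2 ^ k :: nat}"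
  have "visible_pairs (Suc k) (2 ^ k + m) = ?D \<union> ?U \<union> ?up ` ?V"
  proof (rule set_eqI, clarify)
    fix x y :: nat
    have up: "(x, y) \<in> ?up ` ?V \<longleftrightarrow> (\<exists>x' y'. x = 2 ^ k + x' \<and> y = 2 ^ k + y' \<and> (x', y') \<in> ?V)" by auto
    show "(x, y) \<in> visible_pairs (Suc k) (2 ^ k + m) \<longleftrightarrow> (x, y) \<in> ?D \<union> ?U \<union> ?up ` ?V"
    proof (cases "x < 2 ^ k + 2 ^ k \<and> y < 2 ^ k + m")
      case True
      then have "x < 2 ^ k + 2 ^ k" "y < 2 ^ k + m" by auto
      from this(2) show ?thesis
      proof (cases rule: less_split_exp)
        case y: 1
        from \<open>x < 2 ^ k + 2 ^ k\<close> show ?thesis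
          by (cases rule: less_split_exp; unfold Un_iff up)
             (use y in \<open>auto simp: visible_pairs_def visible_Suc_split\<close>)
      next
        case y: (2 y')
        then have "y' < 2 ^ k" using assms by simp
        from \<open>x < 2 ^ k + 2 ^ k\<close> show ?thesis
          by (cases rule: less_split_exp; unfold Un_iff up)
             (use y \<open>y' < 2 ^ k\<close> in \<open>auto simp: visible_pairs_def visible_Suc_split\<close>)
      qed
    next
      case False
      then show ?thesis unfolding Un_iff up using assms by (auto simp: visible_pairs_def)
    qed
  qed
  moreover have "inj_on ?up ?V" by (auto simp: inj_on_def)
  moreover have "card ?D = 2 ^ k" "card ?U = 2 ^ k - m" by (auto simp: card_image inj_on_def)
  moreover have "?D \<inter> ?U = {}" "(?D \<union> ?U) \<inter> ?up ` ?V = {}" by (auto simp: visible_pairs_def)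
  ultimately have "card (visible_pairs (Suc k) (2 ^ k + m)) = 2 ^ k + (2 ^ k - m) + card ?V"
    by (simp add: card_Un_disjoint card_image)
  then show ?thesis using assms by simp
qed

lemma card_visible_pairs_full: "card (visible_pairs k (2 ^ k)) = 2 ^ k"
proof -
  have "visible_pairs k (2 ^ k) = (\<lambda>y. (y, y)) ` {..<2 ^ k}"
    by (auto simp: visible_pairs_def visible_low)
  then show ?thesis by (simp add: card_image inj_on_def)
qed

lemma visible_pairs_0 [simp]: "visible_pairs k 0 = {}"
  by (simp add: visible_pairs_def)

lemma rigid_pairs_0 [simp]: "rigid_pairs 0 = {}"
  by (simp add: rigid_pairs_def)

text \<open>
  Flips within the lower layer never leave the cube, and flips within the upper layer stay below
  \<open>2 ^ k + m\<close> exactly if they stay below \<open>m\<close> after removal of the top bit.  So rigidity within each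
  layer is rigidity for a smaller number, and the remaining pairs are the visible ones.
\<close>

lemma card_rigid_pairs_add:
  assumes "m \<le> 2 ^ k"
  shows "card (rigid_pairs (2 ^ k + m)) =
    card (rigid_pairs (2 ^ k)) + card (visible_pairs k m) + card (rigid_pairs m)"
proof -
  let ?cross = "\<lambda>(x, y). (x, 2 ^ k + y) :: nat \<times> nat"
  let ?up = "\<lambda>(x, y). (2 ^ k + x, 2 ^ k + y) :: nat \<times> nat"
  let ?L = "rigid_pairs (2 ^ k)" and ?C = "?cross ` visible_pairs k m" and ?U = "?up ` rigid_pairs m"
  have "rigid_pairs (2 ^ k + m) = ?L \<union> ?C \<union> ?U"
  proof (rule set_eqI, clarify)
    fix x y :: nat
    have cross: "(x, y) \<in> ?C \<longleftrightarrow> (\<exists>y'. y = 2 ^ k + y' \<and> (x, y') \<in> visible_pairs k m)" by auto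
    have up: "(x, y) \<in> ?U \<longleftrightarrow> (\<exists>x' y'. x = 2 ^ k + x' \<and> y = 2 ^ k + y' \<and> (x', y') \<in> rigid_pairs m)"
      by auto
    show "(x, y) \<in> rigid_pairs (2 ^ k + m) \<longleftrightarrow> (x, y) \<in> ?L \<union> ?C \<union> ?U"
    proof (cases "x < y \<and> y < 2 ^ k + m")
      case True
      then have "x < 2 ^ k + m" "y < 2 ^ k + m" by auto
      from this(2) show ?thesis
      proof (cases rule: less_split_exp)
        case y: 1
        then have "x < 2 ^ k" using True by simp
        then show ?thesis unfolding Un_iff cross up
          using y by (auto simp: rigid_pairs_def rigid_low)
      next
        case y: (2 y')
        then have y'k: "y' < 2 ^ k" using assms by simp
        from \<open>x < 2 ^ k + m\<close> show ?thesis
        proof (cases rule: less_split_exp)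
          case 1
          then show ?thesis unfolding Un_iff cross up
            using y assms by (auto simp: rigid_pairs_def visible_pairs_def rigid_cross)
        next
          case (2 x')
          then have "x' < 2 ^ k" using assms by simp
          then show ?thesis unfolding Un_iff cross up
            using y 2 y'k by (auto simp: rigid_pairs_def visible_pairs_def rigid_high)
        qed
      qed
    next
      case False
      then show ?thesis unfolding Un_iff cross up
        using assms by (auto simp: rigid_pairs_def visible_pairs_def)
    qed
  qed
  moreover have "inj_on ?cross (visible_pairs k m)" "inj_on ?up (rigid_pairs m)"
    by (auto simp: inj_on_def)
  moreover have "?L \<inter> ?C = {}" "(?L \<union> ?C) \<inter> ?U = {}"
    by (auto simp: rigid_pairs_def visible_pairs_def)
  ultimately show ?thesis by (simp add: card_Un_disjoint card_image)
qed

text \<open>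
  The number of edges of the \<open>k\<close>-cube.  It is obtained from the same recursion, since a \<open>k\<close>-cube is
  the case \<open>m = 2 ^ k\<close> one dimension lower.
\<close>

lemma card_rigid_pairs_exp: "2 * card (rigid_pairs (2 ^ k)) = k * 2 ^ k"
proof (induction k)
  case 0
  have "rigid_pairs 1 = {}" by (auto simp: rigid_pairs_def)
  then show ?case by simp
next
  case (Suc k)
  have "card (rigid_pairs (2 ^ Suc k)) = 2 * card (rigid_pairs (2 ^ k)) + 2 ^ k"
    using card_rigid_pairs_add[of "2 ^ k" k] by (simp add: card_visible_pairs_full mult_2)
  then show ?case using Suc by simp
qed

section \<open>Closed form for the number of rigid pairs\<close>

text \<open>
  For the decreasing list \<open>s\<close> of exponents of \<open>m\<close>, this is the number of pairs in
  \<open>visible_pairs k m\<close> divided by \<open>2 ^ k\<close>, which is the same for all \<open>k\<close> above the exponents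
  (\<open>card_visible_pairs_list\<close>).
\<close>

fun cross_count :: "nat list \<Rightarrow> real" where
  "cross_count [] = 0"
| "cross_count (a # s) = (2 - real (\<Sum>b\<leftarrow>s. 2 ^ b) / 2 ^ a + cross_count s) / 2"

text \<open>
  The leading exponent \<open>a\<close> contributes the edges of an \<open>a\<close>-cube and the pairs that join this cube to
  the polytope given by the remaining exponents.
\<close>

fun edge_count :: "nat list \<Rightarrow> real" where
  "edge_count [] = 0"
| "edge_count (a # s) = 2 ^ a * (real a / 2 + cross_count s) + edge_count s"

lemma sum_list_exp_less:
  assumes "sorted_wrt (>) s" "\<And>a. a \<in> set s \<Longrightarrow> a < k"
  shows "(\<Sum>a\<leftarrow>s. 2 ^ a) < (2 ^ k :: nat)"
  using assms
proof (induction s arbitrary: k)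
  case (Cons a s)
  then have "(\<Sum>a\<leftarrow>s. 2 ^ a) < (2 ^ a :: nat)" by auto
  moreover have "(2 :: nat) ^ Suc a \<le> 2 ^ k" using Cons.prems(2)[of a] by (intro power_increasing) auto
  ultimately show ?case by simp
qed simp

lemma card_visible_pairs_list:
  assumes "sorted_wrt (>) s" "\<And>a. a \<in> set s \<Longrightarrow> a < k"
  shows "real (card (visible_pairs k (\<Sum>a\<leftarrow>s. 2 ^ a))) = 2 ^ k * cross_count s"
  using assms
proof (induction k arbitrary: s)
  case 0
  then show ?case by (cases s) auto
next
  case (Suc k)
  show ?case
  proof (cases "\<forall>a\<in>set s. a < k")
    case True
    then have "(\<Sum>a\<leftarrow>s. 2 ^ a) < (2 ^ k :: nat)" using sum_list_exp_less Suc.prems by blast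
    then show ?thesis using card_visible_pairs_Suc_low[of "\<Sum>a\<leftarrow>s. 2 ^ a" k] Suc.IH[of s] Suc.prems(1) True
      by simp
  next
    case False
    then obtain t where s: "s = k # t"
    proof (cases s)
      case (Cons a t)
      then have "a = k" using False Suc.prems by (fastforce simp: less_Suc_eq)
      then show ?thesis using Cons that by blast
    qed simp
    then have t: "sorted_wrt (>) t" "\<And>a. a \<in> set t \<Longrightarrow> a < k" using Suc.prems by auto
    let ?m = "\<Sum>a\<leftarrow>t. 2 ^ a :: nat"
    have "?m \<le> 2 ^ k" using sum_list_exp_less[OF t] by simp
    from arg_cong[OF card_visible_pairs_Suc_high[OF this], of real]
    have "real (card (visible_pairs (Suc k) (2 ^ k + ?m))) = 2 ^ Suc k - real ?m + 2 ^ k * cross_count t"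
      using Suc.IH[OF t] by simp
    moreover have "2 ^ Suc k * ((2 - M / 2 ^ k + c) / 2) = 2 ^ Suc k - M + 2 ^ k * c" for M c :: real
      by (simp add: field_simps)
    ultimately show ?thesis by (simp only: s list.map sum_list.Cons cross_count.simps)
  qed
qed

lemma card_rigid_pairs_list:
  assumes "sorted_wrt (>) s"
  shows "real (card (rigid_pairs (\<Sum>a\<leftarrow>s. 2 ^ a))) = edge_count s"
  using assms
proof (induction s)
  case (Cons a s)
  then have s: "sorted_wrt (>) s" "\<And>b. b \<in> set s \<Longrightarrow> b < a" by auto
  have "real (card (rigid_pairs (2 ^ a))) = 2 ^ a * (real a / 2)"
    using arg_cong[OF card_rigid_pairs_exp[of a], of real] by (simp add: mult.commute)
  then show ?case
    using card_rigid_pairs_add[of "\<Sum>b\<leftarrow>s. 2 ^ b" a] sum_list_exp_less[OF s] card_visible_pairs_list[OF s]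
      Cons.IH[OF s(1)]
    by (simp add: algebra_simps)
qed simp

lemma cross_count_le: "cross_count s \<le> 2"
proof (induction s)
  case (Cons a s)
  have "0 \<le> real (\<Sum>b\<leftarrow>s. 2 ^ b) / 2 ^ a" by simp
  moreover have "(2 - t + c) / 2 \<le> 2" if "c \<le> 2" "0 \<le> t" for t c :: real using that by simp
  ultimately show ?case using Cons unfolding cross_count.simps by blast
qed simp

lemma edge_count_le:
  assumes "\<And>a. a \<in> set s \<Longrightarrow> a < d"
  shows "2 * edge_count s \<le> real (\<Sum>a\<leftarrow>s. 2 ^ a) * (real d + 4)"
  using assms
proof (induction s)
  case (Cons a s)
  have "real a / 2 + cross_count s \<le> (real d + 4) / 2"
    using cross_count_le[of s] Cons.prems[of a] by simp
  then have "2 ^ a * (real a / 2 + cross_count s) \<le> 2 ^ a * ((real d + 4) / 2)"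
    by (intro mult_left_mono) auto
  with Cons show ?case by (simp add: algebra_simps)
qed simp

lemma sum_from_Suc: "(\<Sum>q = Suc p..Suc n. f q) = (\<Sum>q = p..n. f (Suc q))"
  for f :: "nat \<Rightarrow> 'a :: comm_monoid_add"
  by (rule sum.shift_bounds_cl_Suc_ivl)

lemma sum_list_eq_sum_nth1: "(\<Sum>a\<leftarrow>s. f a) = (\<Sum>r = 1..length s. f (s ! (r - 1)))"
  for f :: "'b \<Rightarrow> 'a :: comm_monoid_add"
  by (simp add: sum_list_sum_nth sum.atLeast1_atMost_eq atLeast0LessThan)

text \<open>
  The innermost expression of the edge formula, with the exponents \<open>\<sigma>\<close> read off from a list.  The
  list is indexed from 0 and \<open>q\<close> from 1.
\<close>

definition cross_term :: "nat list \<Rightarrow> nat \<Rightarrow> real" where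
  "cross_term s q = 2 - (\<Sum>r = q + 1..length s. 2 ^ (s ! (r - 1))) * 2 powi - int (s ! (q - 1))"

lemma cross_term_Cons:
  "cross_term (a # s) 1 = 2 - real (\<Sum>b\<leftarrow>s. 2 ^ b) / 2 ^ a"
  "1 \<le> q \<Longrightarrow> cross_term (a # s) (Suc q) = cross_term s q"
proof -
  have sum: "(\<Sum>r = Suc q + 1..length (a # s). 2 ^ ((a # s) ! (r - 1))) =
      (\<Sum>r = q + 1..length s. 2 ^ (s ! (r - 1)) :: real)" for q
    unfolding list.size add_Suc_right add_0_right add_Suc sum_from_Suc by (rule sum.cong) auto
  show "cross_term (a # s) (Suc q) = cross_term s q" if "1 \<le> q"
    unfolding cross_term_def sum using that by simp
  have "real (\<Sum>b\<leftarrow>s. 2 ^ b) = (\<Sum>b\<leftarrow>s. 2 ^ b)" by (induction s) auto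
  also have "\<dots> = (\<Sum>r = 1..length s. 2 ^ (s ! (r - 1)))" by (rule sum_list_eq_sum_nth1)
  finally show "cross_term (a # s) 1 = 2 - real (\<Sum>b\<leftarrow>s. 2 ^ b) / 2 ^ a"
    using sum[of 0] by (simp add: cross_term_def power_int_minus divide_inverse)
qed

lemma cross_count_eq_sum:
  "cross_count s = (\<Sum>q = 1..length s. 2 powi - int q * cross_term s q)"
proof (induction s)
  case (Cons a s)
  have "(\<Sum>q = 1..length (a # s). 2 powi - int q * cross_term (a # s) q)
      = 2 powi - 1 * cross_term (a # s) 1 + (\<Sum>q = Suc 1..Suc (length s). 2 powi - int q * cross_term (a # s) q)"
    by (subst sum.atLeast_Suc_atMost) auto
  also have "(\<Sum>q = Suc 1..Suc (length s). 2 powi - int q * cross_term (a # s) q)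
      = (\<Sum>q = 1..length s. 2 powi - int (Suc q) * cross_term (a # s) (Suc q))"
    by (rule sum_from_Suc)
  also have "\<dots> = (\<Sum>q = 1..length s. (2 powi - int q * cross_term s q) / 2)"
  proof (rule sum.cong)
    fix q assume "q \<in> {1..length s}"
    then have "cross_term (a # s) (Suc q) = cross_term s q" by (intro cross_term_Cons) simp
    moreover have "(2 :: real) powi - int (Suc q) = 2 powi - int q / 2"
      unfolding power_int_minus power_int_of_nat by simp
    ultimately show "2 powi - int (Suc q) * cross_term (a # s) (Suc q) = 2 powi - int q * cross_term s q / 2"
      by simp
  qed simp
  also have "\<dots> = cross_count s / 2" unfolding Cons sum_divide_distrib ..
  finally show ?case unfolding cross_term_Cons(1) by (simp add: field_simps power_int_minus)
qed simp

lemma edge_count_eq_sum: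
  "edge_count s = (\<Sum>p = 1..length s. 2 ^ (s ! (p - 1)) * (real (s ! (p - 1)) / 2 +
     (\<Sum>q = p + 1..length s. 2 powi (int p - int q) * cross_term s q)))"
proof (induction s)
  case (Cons a s)
  let ?h = "\<lambda>s p. 2 ^ (s ! (p - 1)) * (real (s ! (p - 1)) / 2 +
     (\<Sum>q = p + 1..length s. 2 powi (int p - int q) * cross_term s q))"
  have q: "(\<Sum>q = Suc p + 1..length (a # s). 2 powi (int (Suc p) - int q) * cross_term (a # s) q)
      = (\<Sum>q = p + 1..length s. 2 powi (int p - int q) * cross_term s q)" for p
  proof -
    have "(\<Sum>q = Suc p + 1..length (a # s). 2 powi (int (Suc p) - int q) * cross_term (a # s) q)
      = (\<Sum>q = p + 1..length s. 2 powi (int (Suc p) - int (Suc q)) * cross_term (a # s) (Suc q))"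
      using sum_from_Suc[of "\<lambda>q. 2 powi (int (Suc p) - int q) * cross_term (a # s) q" "p + 1" "length s"] by simp
    also have "\<dots> = (\<Sum>q = p + 1..length s. 2 powi (int p - int q) * cross_term s q)"
      by (rule sum.cong) (simp_all add: cross_term_Cons)
    finally show ?thesis .
  qed
  have h: "?h (a # s) (Suc p) = ?h s p" if "1 \<le> p" for p
    unfolding q using that by (simp add: nth_Cons')
  have h1: "?h (a # s) 1 = 2 ^ a * (real a / 2 + cross_count s)"
    using q[of 0] cross_count_eq_sum[of s] by simp
  have "(\<Sum>p = 1..length (a # s). ?h (a # s) p) = ?h (a # s) 1 + (\<Sum>p = Suc 1..Suc (length s). ?h (a # s) p)"
    by (subst sum.atLeast_Suc_atMost) auto
  also have "(\<Sum>p = Suc 1..Suc (length s). ?h (a # s) p) = (\<Sum>p = 1..length s. ?h (a # s) (Suc p))"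
    by (rule sum_from_Suc)
  also have "\<dots> = (\<Sum>p = 1..length s. ?h s p)"
    by (rule sum.cong) (use h in auto)
  also have "\<dots> = edge_count s" unfolding Cons ..
  finally show ?case unfolding h1 by simp
qed simp

section \<open>Edges of polytopes spanned by finitely many points\<close>

text \<open>
  The functional \<open>c\<close> defines a supporting hyperplane whose face is spanned by the points of \<open>X\<close> on
  it, and these are just \<open>x\<close> and \<open>y\<close>.
\<close>

lemma exposed_segment_edge:
  fixes X :: "'a::euclidean_space set"
  assumes "finite X" "x \<in> X" "y \<in> X" "x \<noteq> y" "c \<bullet> x = c \<bullet> y"
    and less: "\<And>z. z \<in> X \<Longrightarrow> z \<noteq> x \<Longrightarrow> z \<noteq> y \<Longrightarrow> c \<bullet> z < c \<bullet> x"
  shows "closed_segment x y edge_of convex hull X"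
proof -
  let ?F = "convex hull X \<inter> {z. c \<bullet> z = c \<bullet> x}"
  have "X \<subseteq> {z. c \<bullet> z \<le> c \<bullet> x}" using less assms(5) by force
  then have "convex hull X \<subseteq> {z. c \<bullet> z \<le> c \<bullet> x}"
    by (intro hull_minimal convex_halfspace_le)
  then have face: "?F face_of convex hull X"
    by (intro face_of_Int_supporting_hyperplane_le) auto
  then obtain S where S: "S \<subseteq> X" "?F = convex hull S"
    using face_of_convex_hull_subset[OF finite_imp_compact[OF assms(1)]] by metis
  have "S \<subseteq> {x, y}"
  proof
    fix z assume "z \<in> S"
    then have "z \<in> X" "c \<bullet> z = c \<bullet> x" using S hull_inc[of z S convex] by auto
    then show "z \<in> {x, y}" using less[of z] by auto
  qed
  then have "?F \<subseteq> closed_segment x y"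
    unfolding S(2) segment_convex_hull by (rule hull_mono)
  moreover have "closed_segment x y \<subseteq> ?F"
    unfolding segment_convex_hull
    by (rule hull_minimal)
      (use assms in \<open>auto intro: hull_inc convex_Int convex_hyperplane\<close>)
  ultimately have "?F = closed_segment x y" by (rule subset_antisym)
  with face assms(4) show ?thesis
    by (simp add: edge_of_def segment_convex_hull aff_dim_convex_hull)
qed

lemma edge_endpoints:
  fixes X :: "'a::euclidean_space set"
  assumes "finite X" "e edge_of convex hull X"
  obtains a b where "a \<in> X" "b \<in> X" "a \<noteq> b" "e = closed_segment a b"
proof -
  have e: "e face_of convex hull X" "aff_dim e = 1" using assms(2) by (auto simp: edge_of_def)
  have "compact (convex hull X)" using assms(1) by (simp add: compact_convex_hull finite_imp_compact)
  then have "compact e" "convex e" "e \<noteq> {}" "collinear e"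
    using e face_of_imp_compact[OF _ _ e(1)] face_of_imp_convex[OF e(1)]
    by (auto simp: collinear_aff_dim)
  then obtain a b where ab: "e = closed_segment a b"
    using compact_convex_collinear_segment by metis
  have "a extreme_point_of e" "b extreme_point_of e" by (auto simp: ab extreme_point_of_segment)
  then have "a \<in> X" "b \<in> X"
    using extreme_point_of_face[OF e(1)] extreme_point_of_convex_hull by blast+
  moreover have "a \<noteq> b" using e(2) ab by auto
  ultimately show ?thesis using that ab by blast
qed

text \<open>
  The midpoint of \<open>x\<close> and \<open>y\<close> is that of \<open>a\<close> and \<open>b\<close>, so it lies in the face, and a face contains
  both ends of any segment of \<open>P\<close> that it meets in the interior.
\<close>

lemma edge_swap_endpoint:
  fixes P :: "'a::euclidean_space set"
  assumes "closed_segment a b face_of P" "x \<in> P" "y \<in> P" "x + y = a + b" "x extreme_point_of P"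
  shows "x = a \<or> x = b"
proof -
  have mid: "midpoint x y \<in> closed_segment a b"
    using assms(4) midpoint_in_closed_segment[of a b] by (simp add: midpoint_def)
  have "x \<in> closed_segment a b"
  proof (cases "x = y")
    case True
    then show ?thesis using mid by simp
  next
    case False
    then have "midpoint x y \<in> open_segment x y" by simp
    then show ?thesis using face_ofD[OF assms(1) _ assms(2,3) mid] by blast
  qed
  then show ?thesis
    using assms(5) extreme_point_of_face[OF assms(1)] by (simp add: extreme_point_of_segment)
qed

text \<open>
  Double counting of incidences: the nodes on an edge are its extreme points, which are two.
\<close>

lemma sum_node_degree:
  fixes X :: "'a::euclidean_space set"
  assumes "finite X" "finite (graph_edges (convex hull X))"
  shows "(\<Sum>x\<in>graph_nodes (convex hull X). node_degree (convex hull X) x) =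
    2 * card (graph_edges (convex hull X))"
  unfolding node_degree_def
proof (rule sum_multicount)
  let ?N = "graph_nodes (convex hull X)" and ?E = "graph_edges (convex hull X)"
  have "?N \<subseteq> X" by (auto simp: graph_nodes_def dest: extreme_point_of_convex_hull)
  then show "finite ?N" using assms(1) finite_subset by blast
  show "finite ?E" by fact
  show "\<forall>e\<in>?E. card {x \<in> ?N. x \<in> e} = 2"
  proof
    fix e assume "e \<in> ?E"
    then have e: "e edge_of convex hull X" by (simp add: graph_edges_def)
    obtain a b where ab: "a \<noteq> b" "e = closed_segment a b" using edge_endpoints[OF assms(1) e] by metis
    have "{x \<in> ?N. x \<in> e} = {x. x extreme_point_of e}"
      using extreme_point_of_face[of e "convex hull X"] e by (auto simp: graph_nodes_def edge_of_def)
    also have "\<dots> = {a, b}" by (auto simp: ab extreme_point_of_segment)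
    finally show "card {x \<in> ?N. x \<in> e} = 2" using ab by simp
  qed
qed

section \<open>Numbering cube vertices in reverse-lexicographic order\<close>

lemma comp_at_add: "comp_at (x + y) i = comp_at x i + comp_at y i"
  by (simp add: comp_at_def)

lemma bij_betw_index:
  "bij_betw (\<lambda>i. sorted_list_of_set (UNIV :: 'n::{finite,linorder} set) ! i) {..<CARD('n)} UNIV"
  by (rule bij_betw_nth) auto

lemma comp_at_eqI:
  fixes x y :: "real ^ 'n::{finite,linorder}"
  assumes "\<And>i. i < CARD('n) \<Longrightarrow> comp_at x i = comp_at y i"
  shows "x = y"
proof -
  have "x $ j = y $ j" for j
  proof -
    obtain i where "i < CARD('n)" "j = sorted_list_of_set UNIV ! i"
      using bij_betw_imp_surj_on[OF bij_betw_index[where 'n = 'n]] by auto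
    then show ?thesis using assms[of i] by (simp add: comp_at_def)
  qed
  then show ?thesis by (simp add: vec_eq_iff)
qed

lemma inner_comp_at:
  fixes x y :: "real ^ 'n::{finite,linorder}"
  shows "x \<bullet> y = (\<Sum>i<CARD('n). comp_at x i * comp_at y i)"
proof -
  have "x \<bullet> y = (\<Sum>j\<in>UNIV. x $ j * y $ j)" by (simp add: inner_vec_def)
  also have "\<dots> = (\<Sum>i<CARD('n). comp_at x i * comp_at y i)"
    unfolding comp_at_def by (rule sum.reindex_bij_betw[symmetric, OF bij_betw_index])
  finally show ?thesis .
qed

text \<open>
  The inverse of \<open>comp_at\<close>: the vector with prescribed components in the numbering of the index type.
\<close>

definition vec_of :: "(nat \<Rightarrow> real) \<Rightarrow> real ^ 'n::{finite,linorder}" where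
  "vec_of f = (\<chi> j. f (inv_into {..<CARD('n)} (\<lambda>i. sorted_list_of_set UNIV ! i) j))"

lemma comp_at_vec_of:
  assumes "i < CARD('n::{finite,linorder})"
  shows "comp_at (vec_of f :: real ^ 'n::{finite,linorder}) i = f i"
  using inv_into_f_f[OF bij_betw_imp_inj_on[OF bij_betw_index[where 'n = 'n]], of i] assms
  by (simp add: comp_at_def vec_of_def)

definition point :: "nat \<Rightarrow> real ^ 'n::{finite,linorder}" where
  "point z = vec_of (\<lambda>i. of_bool (bit z i))"

definition revlex_index :: "real ^ 'n::{finite,linorder} \<Rightarrow> nat" where
  "revlex_index x = set_encode (supp x)"

lemma comp_at_point:
  "i < CARD('n::{finite,linorder}) \<Longrightarrow> comp_at (point z :: real ^ 'n::{finite,linorder}) i = of_bool (bit z i)"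
  by (simp add: point_def comp_at_vec_of)

lemma finite_supp: "finite (supp x)"
  by (simp add: supp_def)

lemma bit_index: "bit (revlex_index x) i \<longleftrightarrow> i \<in> supp x"
  using set_encode_inverse[OF finite_supp[of x]] by (auto simp: revlex_index_def set_decode_def bit_iff_odd)

lemma nat_less_exp_if_bits:
  fixes x :: nat
  assumes "\<And>i. bit x i \<Longrightarrow> i < k"
  shows "x < 2 ^ k"
proof -
  have "take_bit k x = x" by (rule bit_eqI) (use assms in \<open>auto simp: bit_take_bit_iff\<close>)
  then show ?thesis by (simp add: take_bit_nat_eq_self_iff)
qed

lemma index_less: "revlex_index (x :: real ^ 'n::{finite,linorder}) < 2 ^ CARD('n::{finite,linorder})"
  by (rule nat_less_exp_if_bits) (simp add: bit_index supp_def)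

lemma point_in_cube: "point z \<in> cube01"
  by (simp add: cube01_def comp_at_point)

lemma point_index: "x \<in> cube01 \<Longrightarrow> point (revlex_index x) = x"
  by (rule comp_at_eqI) (auto simp: comp_at_point bit_index supp_def cube01_def)

lemma index_point:
  assumes "z < 2 ^ CARD('n::{finite,linorder})"
  shows "revlex_index (point z :: real ^ 'n::{finite,linorder}) = z"
  by (rule nat_eq_bits[OF index_less assms]) (simp add: bit_index supp_def comp_at_point)

text \<open>
  Both orders are decided by the largest position where the digits differ.
\<close>

lemma revlex_less_iff_index:
  fixes x y :: "real ^ 'n::{finite,linorder}"
  assumes "x \<in> cube01" "y \<in> cube01"
  shows "revlex_less x y \<longleftrightarrow> revlex_index x < revlex_index y"
proof (cases "x = y")
  case True
  then show ?thesis by (simp add: revlex_less_def)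
next
  case False
  let ?D = "{i. i < CARD('n) \<and> comp_at x i \<noteq> comp_at y i}"
  define m where "m = Max ?D"
  have "?D \<noteq> {}" using False comp_at_eqI by blast
  then have "m \<in> ?D" unfolding m_def by (intro Max_in) auto
  then have m: "m < CARD('n)" "comp_at x m \<noteq> comp_at y m" by auto
  have above: "comp_at x i = comp_at y i" if "m < i" "i < CARD('n)" for i
    using Max_ge[of ?D i] that unfolding m_def by fastforce
  have val: "comp_at x i \<in> {0, 1}" "comp_at y i \<in> {0, 1}" if "i < CARD('n)" for i
    using assms that by (auto simp: cube01_def)
  have bits: "bit (revlex_index x) i \<longleftrightarrow> bit (revlex_index y) i" if "m < i" for i
    using above[OF that] by (auto simp: bit_index supp_def)
  show ?thesis
  proof (cases "comp_at x m = 0")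
    case True
    then have y: "comp_at y m = 1" using val[OF m(1)] m(2) by auto
    have "revlex_index x < revlex_index y"
      by (rule less_by_top_bit[of _ m]) (use True y m bits in \<open>auto simp: bit_index supp_def\<close>)
    then show ?thesis using True y False by (simp add: revlex_less_def m_def Let_def)
  next
    case F: False
    then have x: "comp_at x m = 1" and y: "comp_at y m = 0" using val[OF m(1)] m(2) by auto
    have "revlex_index y < revlex_index x"
      by (rule less_by_top_bit[of _ m]) (use x y m bits in \<open>auto simp: bit_index supp_def\<close>)
    then show ?thesis using x y False by (simp add: revlex_less_def m_def Let_def)
  qed
qed

lemma revlex_initial_set_eq:
  fixes v :: "real ^ 'n::{finite,linorder}"
  assumes "v \<in> cube01"
  shows "revlex_initial_set v = point ` {..<revlex_index v}"
proof (intro set_eqI iffI)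
  fix x assume "x \<in> revlex_initial_set v"
  then have "x \<in> cube01" "revlex_index x < revlex_index v"
    using assms revlex_less_iff_index by (auto simp: revlex_initial_set_def)
  then show "x \<in> point ` {..<revlex_index v}" using point_index by (metis imageI lessThan_iff)
next
  fix x :: "real ^ 'n::{finite,linorder}" assume "x \<in> point ` {..<revlex_index v}"
  then obtain z where z: "x = point z" "z < revlex_index v" by auto
  then have "revlex_index x = z" using index_less[of v] by (simp add: index_point)
  then show "x \<in> revlex_initial_set v"
    using z by (simp add: revlex_initial_set_def point_in_cube revlex_less_iff_index[OF point_in_cube assms])
qed

lemma inj_on_point:
  assumes "n \<le> 2 ^ CARD('n::{finite,linorder})"
  shows "inj_on (point :: nat \<Rightarrow> real ^ 'n::{finite,linorder}) {..<n}"
  by (rule inj_on_inverseI[of _ revlex_index]) (use assms in \<open>simp add: index_point\<close>)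

lemma point_eq_iff:
  assumes "n \<le> 2 ^ CARD('n::{finite,linorder})" "a < n" "b < n"
  shows "point a = (point b :: real ^ 'n::{finite,linorder}) \<longleftrightarrow> a = b"
  using inj_on_eq_iff[OF inj_on_point[OF assms(1)]] assms by simp

lemma inner_point:
  "vec_of c \<bullet> (point z :: real ^ 'n::{finite,linorder}) = lin CARD('n::{finite,linorder}) c z"
  unfolding inner_comp_at lin_def by (rule sum.cong) (auto simp: comp_at_vec_of comp_at_point)

lemma point_flip_add:
  assumes "bit x i \<noteq> bit y i"
  shows "point (flip_bit i x) + point (flip_bit i y) = point x + (point y :: real ^ 'n::{finite,linorder})"
  by (rule comp_at_eqI) (use assms in \<open>auto simp: comp_at_add comp_at_point bit_flip_bit_iff\<close>)

section \<open>The graph of a revlex-initial polytope\<close>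

text \<open>
  Each cube vertex \<open>x\<close> is the strict maximum of its sign functional, so it is not in the convex hull
  of the others.
\<close>

lemma extreme_point_iff:
  fixes n :: nat
  defines "X \<equiv> point ` {..<n} :: (real ^ 'n::{finite,linorder}) set"
  assumes "n \<le> 2 ^ CARD('n::{finite,linorder})"
  shows "p extreme_point_of convex hull X \<longleftrightarrow> p \<in> X"
proof
  assume "p \<in> X"
  then obtain x where x: "p = point x" "x < n" by (auto simp: X_def)
  have xk: "x < 2 ^ CARD('n)" using x assms by simp
  let ?c = "vec_of (toward x) :: real ^ 'n::{finite,linorder}"
  have less: "?c \<bullet> z < ?c \<bullet> p" if z: "z \<in> X" "z \<noteq> p" for z
  proof -
    obtain z' where z': "z = point z'" "z' < n" "z' \<noteq> x" using z x by (auto simp: X_def)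
    then have "z' < 2 ^ CARD('n)" using assms by simp
    from toward_gap[OF xk this z'(3)] show ?thesis by (simp add: x z' inner_point)
  qed
  have "\<not> p \<in> convex hull (X - {p})"
  proof
    assume p: "p \<in> convex hull (X - {p})"
    have "convex {z. ?c \<bullet> z < ?c \<bullet> p}" by (rule convex_halfspace_lt)
    then have "convex hull (X - {p}) \<subseteq> {z. ?c \<bullet> z < ?c \<bullet> p}"
      by (intro hull_minimal) (use less in auto)
    then show False using p by auto
  qed
  moreover have "insert p (X - {p}) = X" using \<open>p \<in> X\<close> by auto
  moreover have "finite (X - {p})" by (simp add: X_def)
  ultimately show "p extreme_point_of convex hull X"
    using extreme_point_of_convex_hull_insert[of "X - {p}" p] by simp
qed (rule extreme_point_of_convex_hull)

text \<open>
  An exchange yields points with the same sum, hence points of the edge; being extreme they can only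
  be its endpoints.  The other direction is \<open>rigid_functional\<close>.
\<close>

lemma segment_edge_iff_rigid:
  assumes "n \<le> 2 ^ CARD('n::{finite,linorder})" "x < y" "y < n"
  shows "closed_segment (point x) (point y) edge_of convex hull (point ` {..<n} :: (real ^ 'n::{finite,linorder}) set)
    \<longleftrightarrow> rigid n x y"
proof
  let ?X = "point ` {..<n} :: (real ^ 'n::{finite,linorder}) set"
  assume e: "closed_segment (point x) (point y) edge_of convex hull ?X"
  show "rigid n x y"
  proof (rule rigidI)
    fix i assume i: "bit x i \<noteq> bit y i" "flip_bit i x < n" "flip_bit i y < n"
    have "point (flip_bit i x) = (point x :: real ^ 'n::{finite,linorder}) \<or> point (flip_bit i x) = (point y :: real ^ 'n::{finite,linorder})"
    proof (rule edge_swap_endpoint)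
      show "closed_segment (point x) (point y) face_of convex hull ?X" using e by (simp add: edge_of_def)
      show "point (flip_bit i x) + point (flip_bit i y) = point x + (point y :: real ^ 'n::{finite,linorder})"
        by (rule point_flip_add[OF i(1)])
      show "point (flip_bit i x) extreme_point_of convex hull ?X"
        using i(2) by (simp add: extreme_point_iff[OF assms(1)])
    qed (use i in \<open>auto intro: hull_inc\<close>)
    then have "flip_bit i x = x \<or> flip_bit i x = y" using i assms by (auto simp: point_eq_iff[OF assms(1)])
    moreover have "flip_bit i x \<noteq> x" by (auto simp: bit_eq_iff bit_flip_bit_iff intro: exI[of _ i])
    ultimately show "flip_bit i x = y" by blast
  qed
next
  let ?X = "point ` {..<n} :: (real ^ 'n::{finite,linorder}) set"
  assume "rigid n x y"
  then obtain c where c: "lin CARD('n) c x = lin CARD('n) c y"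
    "\<And>z. z < n \<Longrightarrow> z \<noteq> x \<Longrightarrow> z \<noteq> y \<Longrightarrow> lin CARD('n) c z < lin CARD('n) c x"
    using rigid_functional[OF assms(2,3,1)] by blast
  show "closed_segment (point x) (point y) edge_of convex hull ?X"
  proof (rule exposed_segment_edge[where c = "vec_of c"])
    show "point x \<noteq> (point y :: real ^ 'n::{finite,linorder})" using assms by (simp add: point_eq_iff[OF assms(1)])
    fix z :: "real ^ 'n::{finite,linorder}" assume z: "z \<in> ?X" "z \<noteq> point x" "z \<noteq> point y"
    then obtain z' where "z = point z'" "z' < n" "z' \<noteq> x" "z' \<noteq> y" by auto
    then show "vec_of c \<bullet> z < vec_of c \<bullet> (point x :: real ^ 'n::{finite,linorder})" using c(2) by (simp add: inner_point)
  qed (use assms c in \<open>auto simp: inner_point\<close>)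
qed

lemma graph_edges_bij:
  assumes "n \<le> 2 ^ CARD('n::{finite,linorder})"
  shows "bij_betw (\<lambda>(x, y). closed_segment (point x) (point y)) (rigid_pairs n)
    (graph_edges (convex hull (point ` {..<n} :: (real ^ 'n::{finite,linorder}) set)))"
proof (rule bij_betw_imageI)
  let ?X = "point ` {..<n} :: (real ^ 'n::{finite,linorder}) set" and ?s = "\<lambda>(x, y). closed_segment (point x) (point y) :: (real ^ 'n::{finite,linorder}) set"
  show "inj_on ?s (rigid_pairs n)"
    by (rule inj_onI) (auto simp: rigid_pairs_def doubleton_eq_iff point_eq_iff[OF assms])
  show "?s ` rigid_pairs n = graph_edges (convex hull ?X)"
  proof (intro subset_antisym subsetI)
    fix e assume "e \<in> graph_edges (convex hull ?X)"
    then have e: "e edge_of convex hull ?X" by (simp add: graph_edges_def)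
    obtain a b where "a \<in> ?X" "b \<in> ?X" "a \<noteq> b" "e = closed_segment a b"
      by (rule edge_endpoints[OF _ e]) auto
    then obtain x y where xy: "x < n" "y < n" "x \<noteq> y" "e = closed_segment (point x) (point y)" by auto
    have "\<exists>x y. x < y \<and> y < n \<and> e = closed_segment (point x) (point y)"
      using xy by (cases "x < y") (auto simp: closed_segment_commute not_less_iff_gr_or_eq)
    then obtain x y where "x < y" "y < n" "e = closed_segment (point x) (point y)" by blast
    then show "e \<in> ?s ` rigid_pairs n"
      using e segment_edge_iff_rigid[OF assms] by (auto simp: rigid_pairs_def)
  qed (auto simp: graph_edges_def rigid_pairs_def segment_edge_iff_rigid[OF assms])
qed

theorem theorem4:
  fixes v :: "real ^ 'n::{finite,linorder}"
  assumes "v \<in> cube01 - {0}"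
  shows "real (card (graph_edges (revlex_initial_polytope v))) =
           (\<Sum>p = 1..weight v. 2 ^ sigma_nth v p *
              (real (sigma_nth v p) / 2 +
               (\<Sum>q = p + 1..weight v. 2 powi (int p - int q) *
                  (2 - (\<Sum>r = q + 1..weight v. 2 ^ sigma_nth v r) * 2 powi (- int (sigma_nth v q))))))
         \<and> average_node_degree (revlex_initial_polytope v) \<le> real CARD('n) + 4"
proof -
  define s where "s = rev (sorted_list_of_set (supp v))"
  define n where "n = revlex_index v"
  let ?X = "point ` {..<n} :: (real ^ 'n::{finite,linorder}) set" and ?P = "revlex_initial_polytope v"
  have P: "?P = convex hull ?X"
    using assms by (simp add: revlex_initial_polytope_def revlex_initial_set_eq n_def)
  have n2: "n \<le> 2 ^ CARD('n)" using index_less[of v] by (simp add: n_def)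
  have sorted: "sorted_wrt (>) s" by (simp add: s_def sorted_wrt_rev)
  have set_s: "set s = supp v" by (simp add: s_def finite_supp)
  have ns: "n = (\<Sum>a\<leftarrow>s. 2 ^ a)"
    unfolding n_def revlex_index_def set_encode_def set_s[symmetric]
    by (subst sum_list_distinct_conv_sum_set) (simp_all add: s_def)
  have card: "real (card (graph_edges ?P)) = edge_count s"
    using bij_betw_same_card[OF graph_edges_bij[OF n2]] card_rigid_pairs_list[OF sorted] by (simp add: P ns)
  have nodes: "graph_nodes ?P = ?X"
    using extreme_point_iff[OF n2] by (auto simp: P graph_nodes_def)
  have cardX: "card ?X = n" by (simp add: card_image inj_on_point[OF n2])
  have "finite (graph_edges ?P)"
    using bij_betw_finite[OF graph_edges_bij[OF n2]] by (simp add: P)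
  then have deg: "(\<Sum>x\<in>graph_nodes ?P. node_degree ?P x) = 2 * card (graph_edges ?P)"
    unfolding P by (intro sum_node_degree) auto
  have "average_node_degree ?P = 2 * edge_count s / real n"
    unfolding average_node_degree_def of_nat_sum[symmetric] deg by (simp add: card nodes cardX)
  also have "\<dots> \<le> real CARD('n) + 4"
  proof (cases "n = 0")
    case False
    have "2 * edge_count s \<le> real n * (real CARD('n) + 4)"
      unfolding ns by (rule edge_count_le) (simp add: set_s supp_def)
    then show ?thesis using False by (simp add: divide_le_eq mult.commute)
  qed simp
  finally have "average_node_degree ?P \<le> real CARD('n) + 4" .
  moreover have "weight v = length s" by (simp add: s_def weight_def)
  moreover have "sigma_nth v p = s ! (p - 1)" for p by (simp add: s_def sigma_nth_def)
  ultimately show ?thesis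
    using card by (simp only: edge_count_eq_sum cross_term_def)
qed

end
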